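(* Let $\mathrm{K}_V^{\mathbf t}$ be a complete $\mathbf t$-spread $d$-partite hypergraph with $\mathbf t=(t_1,\dots,t_{d-1})$, let $u=x_{k_1}x_{k_2}\cdots x_{k_d}\in\mathcal{G}(I(\mathrm{K}_V^{\mathbf t}))$ with $k_j\in V_j$ for all $j$, and let $i_1=\min V_1$. Then $$\mathrm{set}(u)=\big([i_1,k_1-1]\cap V_1\big)\ \cup\ \bigcup_{j=2}^{d}\big([k_{j-1}+t_{j-1},\,k_j-1]\cap V_j\big).$$
   Context: Setting. Let $n,d\ge 1$ be integers, $[n]=\{1,\dots,n\}$, and let $\mathbf t=(t_1,\dots,t_{d-1})$ be a vector of integers with $t_i\ge 1$ for all $i$. Let $V=\{V_1,\dots,V_d\}$ be a family of nonempty, pairwise disjoint subsets of $[n]$ such that $p<q$ whenever $p\in V_i$, $q\in V_j$ and $i<j$. A $\mathbf t$-spread edge is a set $\{k_1,\dots,k_d\}$ with $k_j\in V_j$ for $j=1,\dots,d$ and $k_j-k_{j-1}\ge t_{j-1}$ for $j=2,\dots,d$. The complete $\mathbf t$-spread $d$-partite hypergraph $\mathrm{K}_V^{\mathbf t}$ is the hypergraph with vertex set $V(\mathrm{K}_V^{\mathbf t})=V_1\cup\dots\cup V_d$ whose edges are all the $\mathbf t$-spread edges. Standing assumption: $\mathrm{K}_V^{\mathbf t}$ has no isolated vertices, i.e. every vertex belongs to at least one edge. Let $\mathbb{K}$ be a field and $S=\mathbb{K}[x_1,\dots,x_n]$. The edge ideal $I(\mathrm{K}_V^{\mathbf t})\subset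 S$ is the ideal generated by the monomials $x_{k_1}\cdots x_{k_d}$, where $\{k_1,\dots,k_d\}$ runs over the edges of $\mathrm{K}_V^{\mathbf t}$. For integers $a,b$, $[a,b]=\{k\in\mathbb{Z}: a\le k\le b\}$ (empty if $a>b$). $\mathcal{G}(I)$ denotes the minimal set of monomial generators of a monomial ideal $I$. Order $\mathcal{G}(I(\mathrm{K}_V^{\mathbf t}))=\{u_1,\dots,u_r\}$ so that $u_1>_{\mathrm{lex}}u_2>_{\mathrm{lex}}\dots>_{\mathrm{lex}}u_r$, where $>_{\mathrm{lex}}$ is the lexicographic order induced by $x_1>x_2>\dots>x_n$. For $k=2,\dots,r$ set $\mathrm{set}(u_k)=\{i : x_i\in(u_1,\dots,u_{k-1}):(u_k)\}$, and $\mathrm{set}(u_1)=\emptyset$. *)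

theory Defs
  imports "HOL-Library.Poly_Mapping" "HOL-Algebra.Ideal"
begin

text \<open>
  A polynomial is a finitely supported map from exponent vectors to coefficients; its ring
  operations are those of \<^theory>\<open>HOL-Library.Poly_Mapping\<close>. The variables there are indexed by
  all natural numbers, and \<open>polynomial_ring n\<close> is the subring in which only
  \<open>x\<^sub>1, \<dots>, x\<^sub>n\<close> occur.
\<close>

type_synonym 'k mpoly = "(nat \<Rightarrow>\<^sub>0 nat) \<Rightarrow>\<^sub>0 'k"

definition polynomial_ring :: "nat \<Rightarrow> ('k::field) mpoly ring" where
  "polynomial_ring n =
     \<lparr>carrier = {p. \<forall>a\<in>Poly_Mapping.keys p. Poly_Mapping.keys a \<subseteq> {1..n}},
      mult = (*), one = 1, zero = 0, add = (+)\<rparr>"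

definition monomial :: "(nat \<Rightarrow>\<^sub>0 nat) \<Rightarrow> ('k::field) mpoly" where
  "monomial a = Poly_Mapping.single a 1"

definition var :: "nat \<Rightarrow> ('k::field) mpoly" where
  "var i = monomial (Poly_Mapping.single i 1)"

definition monomials :: "nat \<Rightarrow> ('k::field) mpoly set" where
  "monomials n = {monomial a | a. Poly_Mapping.keys a \<subseteq> {1..n}}"

text \<open>
  The order on exponent vectors in \<^theory>\<open>HOL-Library.Poly_Mapping\<close> compares them at the smallest
  index at which they differ, so it is the lexicographic order with \<open>x\<^sub>1 > x\<^sub>2 > \<dots> > x\<^sub>n\<close>.
\<close>

definition lex_greater :: "('k::field) mpoly \<Rightarrow> 'k mpoly \<Rightarrow> bool"  (infix \<open>>\<^sub>l\<^sub>e\<^sub>x\<close> 50) where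
  "p >\<^sub>l\<^sub>e\<^sub>x q \<longleftrightarrow> (\<exists>a b. p = monomial a \<and> q = monomial b \<and> a > b)"

lemma polynomial_ring_cring: "cring (polynomial_ring n :: ('k::field) mpoly ring)"
proof (rule cringI)
  show "abelian_group (polynomial_ring n :: 'k mpoly ring)"
  proof (rule abelian_groupI)
    fix p q :: "'k mpoly"
    assume "p \<in> carrier (polynomial_ring n)" "q \<in> carrier (polynomial_ring n)"
    then show "p \<oplus>\<^bsub>polynomial_ring n\<^esub> q \<in> carrier (polynomial_ring n)"
      using Poly_Mapping.keys_add[of p q] by (auto simp: polynomial_ring_def)
  next
    fix p :: "'k mpoly"
    assume "p \<in> carrier (polynomial_ring n)"
    then show "\<exists>q\<in>carrier (polynomial_ring n). q \<oplus>\<^bsub>polynomial_ring n\<^esub> p = \<zero>\<^bsub>polynomial_ring n\<^esub>"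
      by (intro bexI[of _ "- p"]) (auto simp: polynomial_ring_def in_keys_iff)
  qed (auto simp: polynomial_ring_def algebra_simps)
  show "comm_monoid (polynomial_ring n :: 'k mpoly ring)"
  proof (rule comm_monoidI)
    fix p q :: "'k mpoly"
    assume pq: "p \<in> carrier (polynomial_ring n)" "q \<in> carrier (polynomial_ring n)"
    have "Poly_Mapping.keys c \<subseteq> {1..n}" if c: "c \<in> Poly_Mapping.keys (p * q)" for c
    proof -
      obtain a b where ab: "c = a + b" "a \<in> Poly_Mapping.keys p" "b \<in> Poly_Mapping.keys q"
        using keys_mult[of p q] c by blast
      with pq Poly_Mapping.keys_add[of a b] show ?thesis
        unfolding polynomial_ring_def by fastforce
    qed
    then show "p \<otimes>\<^bsub>polynomial_ring n\<^esub> q \<in> carrier (polynomial_ring n)"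
      by (simp add: polynomial_ring_def)
  qed (auto simp: polynomial_ring_def algebra_simps)
qed (auto simp: polynomial_ring_def algebra_simps)

definition colon_ideal :: "('a, 'm) ring_scheme \<Rightarrow> 'a set \<Rightarrow> 'a set \<Rightarrow> 'a set" where
  "colon_ideal R I J = {f \<in> carrier R. \<forall>g\<in>J. f \<otimes>\<^bsub>R\<^esub> g \<in> I}"

definition minimal_monomial_generators :: "nat \<Rightarrow> ('k::field) mpoly set \<Rightarrow> 'k mpoly set \<Rightarrow> bool" where
  "minimal_monomial_generators n I G \<longleftrightarrow>
     G \<subseteq> monomials n \<and> Idl\<^bsub>polynomial_ring n\<^esub> G = I \<and>
     (\<forall>H. H \<subset> G \<longrightarrow> Idl\<^bsub>polynomial_ring n\<^esub> H \<noteq> I)"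

text \<open>
  List positions start at \<open>0\<close>: with \<open>us = [u\<^sub>1, \<dots>, u\<^sub>r]\<close>, the set of \<open>u\<^sub>k\<close> is
  \<open>set_of_generator n us (k - 1)\<close>.
\<close>

definition set_of_generator :: "nat \<Rightarrow> ('k::field) mpoly list \<Rightarrow> nat \<Rightarrow> nat set" where
  "set_of_generator n us m =
     (if m = 0 then {}
      else {i \<in> {1..n}. var i \<in> colon_ideal (polynomial_ring n)
              (Idl\<^bsub>polynomial_ring n\<^esub> (set (take m us))) (Idl\<^bsub>polynomial_ring n\<^esub> {us ! m})})"

type_synonym hypergraph = "nat set \<times> nat set set"  \<comment> \<open>vertices and edges\<close>

definition no_isolated_vertices :: "hypergraph \<Rightarrow> bool" where
  "no_isolated_vertices H \<longleftrightarrow> (\<forall>v\<in>fst H. \<exists>e\<in>snd H. v \<in> e)"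

definition edge_ideal :: "nat \<Rightarrow> hypergraph \<Rightarrow> ('k::field) mpoly set" where
  "edge_ideal n H = Idl\<^bsub>polynomial_ring n\<^esub> {\<Prod>i\<in>e. var i | e. e \<in> snd H}"

definition spread_edge :: "nat \<Rightarrow> (nat \<Rightarrow> nat) \<Rightarrow> (nat \<Rightarrow> nat set) \<Rightarrow> nat set \<Rightarrow> bool" where
  "spread_edge d t V e \<longleftrightarrow>
     (\<exists>k. e = k ` {1..d} \<and> (\<forall>j\<in>{1..d}. k j \<in> V j) \<and>
          (\<forall>j\<in>{2..d}. int (k j) - int (k (j - 1)) \<ge> int (t (j - 1))))"

definition complete_spread_hypergraph ::
  "nat \<Rightarrow> (nat \<Rightarrow> nat) \<Rightarrow> (nat \<Rightarrow> nat set) \<Rightarrow> hypergraph" where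
  "complete_spread_hypergraph d t V = ((\<Union>j\<in>{1..d}. V j), {e. spread_edge d t V e})"

end

theory Submission
  imports Defs
begin

text \<open>
  Membership of a monomial in a monomial ideal is divisibility by a generator
  (\<open>monomial_in_genideal_iff\<close>). All edges have \<open>d\<close> vertices, so no edge monomial divides another,
  and the minimal monomial generators are exactly the edge monomials
  (\<open>minimal_monomial_generators_antichain\<close>). Since the generators are listed in decreasing
  lexicographic order, \<open>i\<close> lies in the set of the generator with edge \<open>e\<close> if and only if some
  edge \<open>f\<close> with a lexicographically larger monomial satisfies \<open>f \<subseteq> e \<union> {i}\<close>
  (\<open>in_set_of_generator_iff\<close>).

  Such an \<open>f\<close> is obtained from \<open>e\<close> by replacing a single vertex by \<open>i\<close>. Both edges meet every
  \<open>V\<^sub>j\<close> exactly once, so the vertex replaced lies in the same part \<open>V\<^sub>j\<close> as \<open>i\<close>, and it is \<open>k\<^sub>j\<close>. The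
  lexicographic condition then says \<open>i < k\<^sub>j\<close>. The result is an edge exactly when \<open>i\<close> keeps the
  distance \<open>t\<^sub>j\<^sub>-\<^sub>1\<close> from \<open>k\<^sub>j\<^sub>-\<^sub>1\<close>; the distance to \<open>k\<^sub>j\<^sub>+\<^sub>1\<close> only grows. This is \<open>exchange_iff\<close>, and it
  gives the intervals of the theorem.
\<close>

section \<open>Divisibility of monomials and the lexicographic order on squarefree ones\<close>

text \<open>
  Divisibility of the monomials with exponent vectors \<open>a\<close> and \<open>b\<close>. The order \<open>\<le>\<close> on exponent
  vectors is lexicographic, so it cannot express this.
\<close>

definition exp_dvd :: "(nat \<Rightarrow>\<^sub>0 nat) \<Rightarrow> (nat \<Rightarrow>\<^sub>0 nat) \<Rightarrow> bool" where
  "exp_dvd a b \<longleftrightarrow> (\<forall>i. Poly_Mapping.lookup a i \<le> Poly_Mapping.lookup b i)"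

lemma exp_dvd_refl [simp]: "exp_dvd a a"
  by (simp add: exp_dvd_def)

lemma exp_dvd_trans: "exp_dvd a b \<Longrightarrow> exp_dvd b c \<Longrightarrow> exp_dvd a c"
  unfolding exp_dvd_def using order_trans by blast

lemma exp_dvd_antisym: "exp_dvd a b \<Longrightarrow> exp_dvd b a \<Longrightarrow> a = b"
  by (rule poly_mapping_eqI) (simp add: exp_dvd_def order_antisym)

lemma exp_dvd_add: "exp_dvd a b \<Longrightarrow> exp_dvd a (c + b)"
  by (simp add: exp_dvd_def lookup_add trans_le_add2)

lemma exp_dvd_obtain_cofactor:
  assumes "exp_dvd a b"
  obtains c where "b = c + a" "Poly_Mapping.keys c \<subseteq> Poly_Mapping.keys b"
proof
  show "b = (b - a) + a"
    using assms by (intro poly_mapping_eqI) (simp add: exp_dvd_def lookup_add lookup_minus)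
  show "Poly_Mapping.keys (b - a) \<subseteq> Poly_Mapping.keys b"
    by (auto simp: in_keys_iff lookup_minus)
qed

text \<open>
  The exponent vector of the squarefree monomial \<open>\<Prod>i\<in>e. x\<^sub>i\<close>.
\<close>

definition indicator_exponent :: "nat set \<Rightarrow> (nat \<Rightarrow>\<^sub>0 nat)" where
  "indicator_exponent e = (\<Sum>i\<in>e. Poly_Mapping.single i 1)"

lemma lookup_indicator_exponent:
  "finite e \<Longrightarrow> Poly_Mapping.lookup (indicator_exponent e) i = (if i \<in> e then 1 else 0)"
  by (simp add: indicator_exponent_def lookup_sum lookup_single when_def)

lemma keys_indicator_exponent: "finite e \<Longrightarrow> Poly_Mapping.keys (indicator_exponent e) = e"
  by (auto simp: in_keys_iff lookup_indicator_exponent split: if_splits)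

lemma exp_dvd_indicator_exponent:
  "finite e \<Longrightarrow> finite f \<Longrightarrow> exp_dvd (indicator_exponent e) (indicator_exponent f) \<longleftrightarrow> e \<subseteq> f"
  by (auto simp: exp_dvd_def lookup_indicator_exponent)

text \<open>
  Let \<open>u\<close> be the monomial of \<open>e\<close>. If \<open>i \<in> e\<close>, then \<open>x\<^sub>i u\<close> is not squarefree, but a squarefree
  monomial divides it only if it divides \<open>u\<close>; hence \<open>insert\<close> is right in both cases.
\<close>

lemma exp_dvd_var_times_indicator_exponent:
  "finite e \<Longrightarrow> finite f \<Longrightarrow>
     exp_dvd (indicator_exponent f) (Poly_Mapping.single i 1 + indicator_exponent e) \<longleftrightarrow>
     f \<subseteq> insert i e"
  by (auto simp: exp_dvd_def lookup_indicator_exponent lookup_add lookup_single when_def)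

lemma less_indicator_exponent_iff:
  assumes "finite e" "finite f"
  shows "indicator_exponent e < indicator_exponent f \<longleftrightarrow>
           (\<exists>q\<in>f - e. \<forall>p<q. p \<in> e \<longleftrightarrow> p \<in> f)"
  using assms
  by (auto simp: less_poly_mapping.rep_eq less_fun_def lookup_indicator_exponent
      split: if_splits)

lemma monomial_mult: "monomial a * monomial b = monomial (a + b)"
  by (simp add: monomial_def mult_single)

lemma keys_monomial [simp]:
  "Poly_Mapping.keys (monomial a :: ('k::field) mpoly) = {a}"
  by (simp add: monomial_def)

lemma inj_monomial: "inj (monomial :: _ \<Rightarrow> ('k::field) mpoly)"
  by (metis injI keys_monomial singleton_inject)

lemma monomial_eq_iff [simp]: "(monomial a :: ('k::field) mpoly) = monomial b \<longleftrightarrow> a = b"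
  using inj_monomial by (metis injD)

lemma prod_var_eq_monomial: "(\<Prod>i\<in>e. var i) = monomial (indicator_exponent e)"
proof (induction e rule: infinite_finite_induct)
  case (insert i e)
  then show ?case
    by (simp add: indicator_exponent_def var_def monomial_mult)
qed (simp_all add: indicator_exponent_def monomial_def)

lemma lex_greater_monomial_iff [simp]:
  "(monomial a :: ('k::field) mpoly) >\<^sub>l\<^sub>e\<^sub>x monomial b \<longleftrightarrow> b < a"
  by (auto simp: lex_greater_def)

section \<open>Monomial ideals\<close>

lemma monomial_in_carrier_iff:
  "(monomial a :: ('k::field) mpoly) \<in> carrier (polynomial_ring n) \<longleftrightarrow>
     Poly_Mapping.keys a \<subseteq> {1..n}"
  by (simp add: polynomial_ring_def)

lemma polynomial_ring_operations:
  "p \<otimes>\<^bsub>polynomial_ring n\<^esub> q = p * q"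
  "p \<oplus>\<^bsub>polynomial_ring n\<^esub> q = p + q"
  "\<zero>\<^bsub>polynomial_ring n\<^esub> = 0"
  "\<one>\<^bsub>polynomial_ring n\<^esub> = 1"
  by (simp_all add: polynomial_ring_def)

text \<open>
  This ideal consists of the polynomials all of whose terms are divisible by a monomial with
  exponent in \<open>A\<close>. It contains these monomials, so it bounds the ideal that they generate from above.
\<close>

lemma ideal_divisible_keys:
  "ideal {p \<in> carrier (polynomial_ring n). \<forall>b\<in>Poly_Mapping.keys p. \<exists>a\<in>A. exp_dvd a b}
     (polynomial_ring n :: ('k::field) mpoly ring)" (is "ideal ?I ?R")
proof -
  interpret R: cring ?R by (rule polynomial_ring_cring)
  have carrier: "p \<in> carrier ?R" if "p \<in> ?I" for p
    using that by blast
  have add: "p \<oplus>\<^bsub>?R\<^esub> q \<in> ?I" if p: "p \<in> ?I" and q: "q \<in> ?I" for p q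
  proof -
    have "p \<oplus>\<^bsub>?R\<^esub> q \<in> carrier ?R"
      by (intro R.add.m_closed carrier p q)
    moreover have "Poly_Mapping.keys (p \<oplus>\<^bsub>?R\<^esub> q) \<subseteq> Poly_Mapping.keys p \<union> Poly_Mapping.keys q"
      unfolding polynomial_ring_operations by (rule Poly_Mapping.keys_add)
    ultimately show ?thesis
      using p q by blast
  qed
  have mult: "q \<otimes>\<^bsub>?R\<^esub> p \<in> ?I" if p: "p \<in> ?I" and q: "q \<in> carrier ?R" for p q
  proof -
    have "\<exists>a\<in>A. exp_dvd a c" if c: "c \<in> Poly_Mapping.keys (q \<otimes>\<^bsub>?R\<^esub> p)" for c
    proof -
      obtain b' b where "b \<in> Poly_Mapping.keys p" "c = b' + b"
        using c keys_mult[of q p] unfolding polynomial_ring_operations by blast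
      with p show ?thesis
        using exp_dvd_add by blast
    qed
    moreover have "q \<otimes>\<^bsub>?R\<^esub> p \<in> carrier ?R"
      by (intro R.m_closed carrier p q)
    ultimately show ?thesis by blast
  qed
  show ?thesis
  proof (rule idealI)
    show "subgroup ?I (add_monoid ?R)"
    proof (rule R.add.subgroupI)
      show "?I \<noteq> {}"
        using R.zero_closed by (force simp: polynomial_ring_operations)
    next
      fix p assume p: "p \<in> ?I"
      have "\<ominus>\<^bsub>?R\<^esub> \<one>\<^bsub>?R\<^esub> \<otimes>\<^bsub>?R\<^esub> p \<in> ?I"
        by (intro mult p R.a_inv_closed R.one_closed)
      then show "\<ominus>\<^bsub>?R\<^esub> p \<in> ?I"
        using carrier[OF p] by (simp only: R.l_minus R.one_closed R.l_one)
    qed (use carrier add in blast)+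
    fix p q assume pq: "p \<in> ?I" "q \<in> carrier ?R"
    show "q \<otimes>\<^bsub>?R\<^esub> p \<in> ?I"
      by (rule mult[OF pq])
    then show "p \<otimes>\<^bsub>?R\<^esub> q \<in> ?I"
      by (simp only: R.m_comm[OF carrier[OF pq(1)] pq(2)])
  qed (rule R.ring_axioms)
qed

lemma monomial_in_genideal_iff:
  assumes "\<And>a. a \<in> A \<Longrightarrow> Poly_Mapping.keys a \<subseteq> {1..n}"
  shows "(monomial b :: ('k::field) mpoly) \<in> Idl\<^bsub>polynomial_ring n\<^esub> (monomial ` A) \<longleftrightarrow>
           Poly_Mapping.keys b \<subseteq> {1..n} \<and> (\<exists>a\<in>A. exp_dvd a b)"
    (is "_ \<in> Idl\<^bsub>?R\<^esub> ?G \<longleftrightarrow> _")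
proof -
  interpret R: cring ?R by (rule polynomial_ring_cring)
  have G: "?G \<subseteq> carrier ?R"
    using assms by (auto simp: monomial_in_carrier_iff)
  show ?thesis
  proof
    let ?I = "{p \<in> carrier ?R. \<forall>b\<in>Poly_Mapping.keys p. \<exists>a\<in>A. exp_dvd a b}"
    have "?G \<subseteq> ?I"
      using G by (auto intro: exp_dvd_refl)
    then have "Idl\<^bsub>?R\<^esub> ?G \<subseteq> ?I"
      by (intro R.genideal_minimal ideal_divisible_keys)
    moreover assume "monomial b \<in> Idl\<^bsub>?R\<^esub> ?G"
    ultimately have "monomial b \<in> ?I"
      by blast
    then show "Poly_Mapping.keys b \<subseteq> {1..n} \<and> (\<exists>a\<in>A. exp_dvd a b)"
      by (simp add: monomial_in_carrier_iff)
  next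
    assume b: "Poly_Mapping.keys b \<subseteq> {1..n} \<and> (\<exists>a\<in>A. exp_dvd a b)"
    then obtain a c where a: "a \<in> A" and c: "b = c + a" "Poly_Mapping.keys c \<subseteq> {1..n}"
      by (meson exp_dvd_obtain_cofactor order_trans)
    have "monomial c \<otimes>\<^bsub>?R\<^esub> monomial a \<in> Idl\<^bsub>?R\<^esub> ?G"
      using a c R.genideal_self[OF G]
      by (intro ideal.I_l_closed R.genideal_ideal G) (auto simp: monomial_in_carrier_iff)
    then show "monomial b \<in> Idl\<^bsub>?R\<^esub> ?G"
      by (simp add: polynomial_ring_operations monomial_mult c)
  qed
qed

text \<open>
  Every generator in \<open>G\<close> is divisible by some \<open>a\<close> in \<open>A\<close>, and \<open>a\<close> in turn by a generator in \<open>G\<close>. As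
  a minimal generating set has no proper divisibilities, the three are equal. Conversely, a generator in \<open>G\<close>
  that divides an element of \<open>A\<close> comes from \<open>A\<close> itself by the first part, and \<open>A\<close> is an
  antichain.
\<close>

lemma minimal_monomial_generators_antichain:
  assumes A: "\<And>a. a \<in> A \<Longrightarrow> Poly_Mapping.keys a \<subseteq> {1..n}"
    and antichain: "\<And>a b. a \<in> A \<Longrightarrow> b \<in> A \<Longrightarrow> exp_dvd a b \<Longrightarrow> a = b"
    and G: "minimal_monomial_generators n (Idl\<^bsub>polynomial_ring n\<^esub> (monomial ` A)) G"
  shows "G = (monomial ` A :: ('k::field) mpoly set)"
proof -
  let ?R = "polynomial_ring n :: 'k mpoly ring"
  interpret R: cring ?R by (rule polynomial_ring_cring)
  define B where "B = {b. (monomial b :: 'k mpoly) \<in> G}"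
  have monomials: "\<exists>a. v = monomial a \<and> Poly_Mapping.keys a \<subseteq> {1..n}" if "v \<in> G" for v
    using that G unfolding minimal_monomial_generators_def monomials_def by blast
  have GB: "G = monomial ` B"
  proof
    show "G \<subseteq> monomial ` B"
      using monomials unfolding B_def by blast
  qed (auto simp: B_def)
  have B: "Poly_Mapping.keys b \<subseteq> {1..n}" if "b \<in> B" for b
    using that monomials[of "monomial b"] by (simp add: B_def)
  have same_ideal: "Idl\<^bsub>?R\<^esub> (monomial ` B) = Idl\<^bsub>?R\<^esub> (monomial ` A)"
    using G GB by (simp add: minimal_monomial_generators_def)
  have dvd_A: "\<exists>a\<in>A. exp_dvd a b" if "b \<in> B" for b
    using monomial_in_genideal_iff[OF A, where b=b and 'k='k]
      monomial_in_genideal_iff[OF B, where b=b and 'k='k]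
      that B same_ideal exp_dvd_refl by metis
  have dvd_B: "\<exists>b\<in>B. exp_dvd b a" if "a \<in> A" for a
    using monomial_in_genideal_iff[OF A, where b=a and 'k='k]
      monomial_in_genideal_iff[OF B, where b=a and 'k='k]
      that A same_ideal exp_dvd_refl by metis
  have antichain_B: "b' = b" if "b \<in> B" "b' \<in> B" "exp_dvd b' b" for b b'
  proof (rule ccontr)
    assume "b' \<noteq> b"
    \<comment> \<open>Then \<open>b\<close> is redundant: the other monomials of \<open>G\<close> generate the same ideal.\<close>
    let ?H = "monomial ` (B - {b}) :: 'k mpoly set"
    have "monomial c \<in> Idl\<^bsub>?R\<^esub> ?H" if "c \<in> B" for c
      using monomial_in_genideal_iff[of "B - {b}" n c, where 'k='k] that B \<open>b' \<in> B\<close>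
        \<open>exp_dvd b' b\<close> \<open>b' \<noteq> b\<close> exp_dvd_refl by blast
    moreover have H: "?H \<subseteq> carrier ?R" "G \<subseteq> carrier ?R"
      using B by (auto simp: monomial_in_carrier_iff GB)
    ultimately have "Idl\<^bsub>?R\<^esub> G \<subseteq> Idl\<^bsub>?R\<^esub> ?H"
      by (intro R.genideal_minimal R.genideal_ideal) (auto simp: GB)
    moreover have "Idl\<^bsub>?R\<^esub> ?H \<subseteq> Idl\<^bsub>?R\<^esub> G"
      by (intro R.subset_Idl_subset H) (auto simp: GB)
    ultimately have "Idl\<^bsub>?R\<^esub> ?H = Idl\<^bsub>?R\<^esub> G"
      by blast
    moreover have "?H \<subset> G"
      using \<open>b \<in> B\<close> unfolding GB by (blast dest: injD[OF inj_monomial])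
    ultimately show False
      using G by (simp add: minimal_monomial_generators_def)
  qed
  have "B \<subseteq> A"
  proof
    fix b assume b: "b \<in> B"
    then obtain a b' where "a \<in> A" "exp_dvd a b" "b' \<in> B" "exp_dvd b' a"
      using dvd_A dvd_B by meson
    with b show "b \<in> A"
      by (metis antichain_B exp_dvd_antisym exp_dvd_trans)
  qed
  moreover have "A \<subseteq> B"
    using calculation antichain dvd_B by (metis subset_iff)
  ultimately show ?thesis
    using GB by blast
qed

text \<open>
  In a list sorted by the strict order \<open>>\<^sub>l\<^sub>e\<^sub>x\<close>, the entries before position \<open>m\<close> are the entries larger
  than the one at \<open>m\<close>, so positions disappear from the description. Since the first position has
  no entries before it, its empty set is covered without a separate case.
\<close>

lemma in_set_of_generator_iff:
  assumes us: "set us = monomial ` A"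
    and A: "\<And>a. a \<in> A \<Longrightarrow> Poly_Mapping.keys a \<subseteq> {1..n}"
    and sorted: "sorted_wrt lex_greater us"
    and m: "m < length us" "us ! m = (monomial b :: ('k::field) mpoly)"
  shows "i \<in> set_of_generator n us m \<longleftrightarrow>
           i \<in> {1..n} \<and> (\<exists>a\<in>A. b < a \<and> exp_dvd a (Poly_Mapping.single i 1 + b))"
proof -
  let ?R = "polynomial_ring n :: 'k mpoly ring"
  interpret R: cring ?R by (rule polynomial_ring_cring)
  let ?B = "{a \<in> A. b < a}"
  have before: "set (take m us) = monomial ` ?B"
  proof (intro equalityI subsetI)
    fix v assume v: "v \<in> set (take m us)"
    then obtain j where "j < m" "v = us ! j"
      using m by (auto simp: in_set_conv_nth)
    then have "v >\<^sub>l\<^sub>e\<^sub>x monomial b"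
      using sorted m by (metis sorted_wrt_iff_nth_less)
    moreover obtain a where "a \<in> A" "v = monomial a"
      using v us set_take_subset by fastforce
    ultimately show "v \<in> monomial ` ?B"
      by simp
  next
    fix v :: "'k mpoly" assume "v \<in> monomial ` ?B"
    then obtain a where a: "a \<in> A" "b < a" "v = monomial a"
      by blast
    then obtain j where j: "j < length us" "us ! j = monomial a"
      using us by (metis image_eqI in_set_conv_nth)
    have "j < m"
    proof (rule ccontr)
      assume "\<not> j < m"
      then have "j = m \<or> us ! m >\<^sub>l\<^sub>e\<^sub>x us ! j"
        using sorted j by (metis linorder_cases sorted_wrt_iff_nth_less)
      with a j m show False
        by auto
    qed
    with a j m show "v \<in> set (take m us)"
      by (auto simp: in_set_conv_nth intro!: exI[of _ j])
  qed
  have b: "Poly_Mapping.keys b \<subseteq> {1..n}"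
    using us A m by (metis imageE monomial_eq_iff nth_mem)
  have before_carrier: "monomial ` ?B \<subseteq> carrier ?R"
    using A by (auto simp: monomial_in_carrier_iff)
  have "var i \<in> colon_ideal ?R (Idl\<^bsub>?R\<^esub> (monomial ` ?B)) (Idl\<^bsub>?R\<^esub> {monomial b}) \<longleftrightarrow>
          (\<exists>a\<in>A. b < a \<and> exp_dvd a (Poly_Mapping.single i 1 + b))"
    if i: "i \<in> {1..n}"
  proof -
    let ?J = "Idl\<^bsub>?R\<^esub> (monomial ` ?B)"
    have x: "(var i :: 'k mpoly) \<in> carrier ?R" and u: "(monomial b :: 'k mpoly) \<in> carrier ?R"
      using i b by (simp_all add: var_def monomial_in_carrier_iff)
    have J: "ideal ?J ?R"
      by (intro R.genideal_ideal before_carrier)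
    have "var i \<in> colon_ideal ?R ?J (Idl\<^bsub>?R\<^esub> {monomial b}) \<longleftrightarrow>
            var i \<otimes>\<^bsub>?R\<^esub> monomial b \<in> ?J"
    proof
      assume "var i \<in> colon_ideal ?R ?J (Idl\<^bsub>?R\<^esub> {monomial b})"
      then show "var i \<otimes>\<^bsub>?R\<^esub> monomial b \<in> ?J"
        using R.genideal_self'[OF u] by (simp add: colon_ideal_def)
    next
      assume *: "var i \<otimes>\<^bsub>?R\<^esub> monomial b \<in> ?J"
      \<comment> \<open>An element of the principal ideal is a multiple of its generator, so the generator decides.\<close>
      have "var i \<otimes>\<^bsub>?R\<^esub> g \<in> ?J" if g: "g \<in> Idl\<^bsub>?R\<^esub> {monomial b}" for g
      proof -
        obtain r where r: "r \<in> carrier ?R" "g = r \<otimes>\<^bsub>?R\<^esub> monomial b"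
          using g R.cgenideal_eq_genideal[OF u] by (auto simp: cgenideal_def)
        have "r \<otimes>\<^bsub>?R\<^esub> (var i \<otimes>\<^bsub>?R\<^esub> monomial b) \<in> ?J"
          using ideal.I_l_closed[OF J * r(1)] .
        then show ?thesis
          using r x u by (simp add: R.m_lcomm)
      qed
      then show "var i \<in> colon_ideal ?R ?J (Idl\<^bsub>?R\<^esub> {monomial b})"
        using x by (simp add: colon_ideal_def)
    qed
    also have "var i \<otimes>\<^bsub>?R\<^esub> monomial b = monomial (Poly_Mapping.single i 1 + b)"
      by (simp add: polynomial_ring_operations var_def monomial_mult)
    also have "\<dots> \<in> ?J \<longleftrightarrow> (\<exists>a\<in>A. b < a \<and> exp_dvd a (Poly_Mapping.single i 1 + b))"
    proof -
      have "Poly_Mapping.keys (Poly_Mapping.single i 1 + b) \<subseteq> {1..n}"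
        using i b Poly_Mapping.keys_add[of "Poly_Mapping.single i 1" b] by auto
      then show ?thesis
        using monomial_in_genideal_iff[of ?B n, where 'k='k] A by auto
    qed
    finally show ?thesis .
  qed
  moreover have "set_of_generator n us m =
    {i \<in> {1..n}. var i \<in> colon_ideal ?R (Idl\<^bsub>?R\<^esub> (monomial ` ?B)) (Idl\<^bsub>?R\<^esub> {monomial b})}"
    if "m \<noteq> 0"
    using that m before by (simp add: set_of_generator_def)
  moreover have "?B = {}" if "m = 0"
    using before that by simp
  ultimately show ?thesis
    by (cases "m = 0") (auto simp: set_of_generator_def)
qed

section \<open>Exchanging one vertex of a spread edge\<close>

lemma finite_spread_edge: "spread_edge d t V e \<Longrightarrow> finite e"
  by (auto simp: spread_edge_def)

lemma transversal_index_eq: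
  assumes "\<forall>i\<in>{1..d}. \<forall>j\<in>{1..d}. i \<noteq> j \<longrightarrow> V i \<inter> V j = {}"
    and "i \<in> {1..d}" "j \<in> {1..d}" "p \<in> V i" "p \<in> V j"
  shows "i = j"
  using assms by blast

lemma card_spread_edge:
  assumes "\<forall>i\<in>{1..d}. \<forall>j\<in>{1..d}. i \<noteq> j \<longrightarrow> V i \<inter> V j = {}" "spread_edge d t V e"
  shows "card e = d"
proof -
  obtain k where k: "e = k ` {1..d}" "\<forall>j\<in>{1..d}. k j \<in> V j"
    using assms(2) by (auto simp: spread_edge_def)
  have "inj_on k {1..d}"
    using k(2) transversal_index_eq[OF assms(1)] by (metis inj_onI)
  then show ?thesis
    by (simp add: k(1) card_image)
qed

text \<open>
  An edge is spread with respect to some enumeration of its vertices. As the parts are disjoint,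
  an enumeration that takes its \<open>j\<close>-th vertex from \<open>V\<^sub>j\<close> is unique, so the gaps can be read off
  from \<open>k\<close>.
\<close>

lemma spread_edge_vertices:
  assumes disjoint: "\<forall>i\<in>{1..d}. \<forall>j\<in>{1..d}. i \<noteq> j \<longrightarrow> V i \<inter> V j = {}"
    and k: "\<forall>j\<in>{1..d}. k j \<in> V j"
    and edge: "spread_edge d t V (k ` {1..d})"
    and j: "j \<in> {2..d}"
  shows "k (j - 1) + t (j - 1) \<le> k j"
proof -
  obtain k' where k': "k ` {1..d} = k' ` {1..d}" "\<forall>j\<in>{1..d}. k' j \<in> V j"
    and spread: "\<forall>j\<in>{2..d}. int (k' j) - int (k' (j - 1)) \<ge> int (t (j - 1))"
    using edge by (auto simp: spread_edge_def)
  have "k' l = k l" if l: "l \<in> {1..d}" for l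
  proof -
    have "k' l \<in> k ` {1..d}"
      using k' l by blast
    then obtain l' where "l' \<in> {1..d}" "k' l = k l'"
      by blast
    then show ?thesis
      using transversal_index_eq[OF disjoint l, of l' "k' l"] k k' l by metis
  qed
  moreover have "j \<in> {1..d}" "j - 1 \<in> {1..d}"
    using j by auto
  ultimately have "k' j = k j" "k' (j - 1) = k (j - 1)"
    by blast+
  then show ?thesis
    using spread[rule_format, OF j] by simp
qed

text \<open>
  In the direction from left to right, the first vertex at which \<open>f\<close> and \<open>k ` {1..d}\<close> differ
  belongs to \<open>f\<close>, so it is \<open>i\<close>. All vertices of \<open>f\<close> in parts other than that of \<open>i\<close> come from
  \<open>k\<close>, so the vertex \<open>k j\<close> in the part of \<open>i\<close> is missing from \<open>f\<close> and comes after the first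
  difference. Conversely,
  \<open>k(j := i)\<close> enumerates the required edge: its gap on the right of \<open>i\<close> is larger than that of
  \<open>k j\<close>.
\<close>

lemma exchange_iff:
  assumes disjoint: "\<forall>i\<in>{1..d}. \<forall>j\<in>{1..d}. i \<noteq> j \<longrightarrow> V i \<inter> V j = {}"
    and k: "\<forall>j\<in>{1..d}. k j \<in> V j"
    and edge: "spread_edge d t V (k ` {1..d})"
  shows "(\<exists>f. spread_edge d t V f \<and> f \<subseteq> insert i (k ` {1..d}) \<and>
            indicator_exponent (k ` {1..d}) < indicator_exponent f) \<longleftrightarrow>
         (\<exists>j\<in>{1..d}. i \<in> V j \<and> i < k j \<and> (2 \<le> j \<longrightarrow> k (j - 1) + t (j - 1) \<le> i))"
    (is "?lhs \<longleftrightarrow> ?rhs")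
proof
  let ?e = "k ` {1..d}"
  assume ?lhs
  then obtain f where f: "spread_edge d t V f" "f \<subseteq> insert i ?e"
    and less: "indicator_exponent ?e < indicator_exponent f"
    by blast
  from less obtain q where "q \<in> f - ?e" and agree_below_q: "\<forall>p<q. p \<in> ?e \<longleftrightarrow> p \<in> f"
    using finite_spread_edge[OF f(1)] by (auto simp: less_indicator_exponent_iff)
  with f(2) have i: "i \<in> f" "i \<notin> ?e" and agree: "\<forall>p<i. p \<in> ?e \<longleftrightarrow> p \<in> f"
    by auto
  from f(1) obtain k' where k': "f = k' ` {1..d}" "\<forall>j\<in>{1..d}. k' j \<in> V j"
    and spread: "\<forall>j\<in>{2..d}. int (k' j) - int (k' (j - 1)) \<ge> int (t (j - 1))"
    by (auto simp: spread_edge_def)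
  from i(1) obtain j where j: "j \<in> {1..d}" "k' j = i"
    using k' by blast
  have others: "k' l = k l" if l: "l \<in> {1..d}" "l \<noteq> j" for l
  proof -
    have "k' l \<noteq> i"
      using transversal_index_eq[OF disjoint l(1) j(1), of i] k'(2) j l by metis
    then obtain l' where "l' \<in> {1..d}" "k' l = k l'"
      using f(2) k'(1) l by blast
    then show ?thesis
      using transversal_index_eq[OF disjoint l(1), of l' "k' l"] k k' l by metis
  qed
  have "k j \<notin> f"
  proof
    assume "k j \<in> f"
    then obtain l where l: "l \<in> {1..d}" "k j = k' l"
      using k' by blast
    then have "l = j"
      using transversal_index_eq[OF disjoint l(1) j(1), of "k j"] k k' j by metis
    with l j i show False
      by auto
  qed
  then have "i < k j"
    using agree i j by (metis image_eqI linorder_cases)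
  moreover have "k (j - 1) + t (j - 1) \<le> i" if "2 \<le> j"
  proof -
    have "k' (j - 1) = k (j - 1)"
      using that j by (intro others) auto
    then show ?thesis
      using spread[rule_format, of j] that j by auto
  qed
  ultimately show ?rhs
    using j k' by blast
next
  let ?e = "k ` {1..d}"
  assume ?rhs
  then obtain j where j: "j \<in> {1..d}" "i \<in> V j" "i < k j"
    and left: "2 \<le> j \<longrightarrow> k (j - 1) + t (j - 1) \<le> i"
    by blast
  define f where "f = (k(j := i)) ` {1..d}"
  have "spread_edge d t V f"
    unfolding spread_edge_def
  proof (intro exI conjI ballI)
    fix l assume l: "l \<in> {2..d}"
    show "int (t (l - 1)) \<le> int ((k(j := i)) l) - int ((k(j := i)) (l - 1))"
      using spread_edge_vertices[OF disjoint k edge l] l j left by auto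
  qed (use f_def j k in auto)
  moreover have "f \<subseteq> insert i ?e"
    by (auto simp: f_def)
  moreover have "indicator_exponent ?e < indicator_exponent f"
  proof -
    have "i \<notin> ?e"
    proof
      assume "i \<in> ?e"
      then obtain l where l: "l \<in> {1..d}" "i = k l"
        by blast
      then have "l = j"
        using transversal_index_eq[OF disjoint l(1) j(1), of i] k j by metis
      with l j show False
        by simp
    qed
    moreover have "p \<in> ?e \<longleftrightarrow> p \<in> f" if "p < i" for p
      using that j by (auto simp: f_def image_iff)
    moreover have "i \<in> f"
      using j by (auto simp: f_def)
    ultimately show ?thesis
      by (auto simp: less_indicator_exponent_iff f_def)
  qed
  ultimately show ?lhs
    by blast
qed

theorem proposition2p5:
  fixes n d m :: nat
    and t k :: "nat \<Rightarrow> nat"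
    and V :: "nat \<Rightarrow> nat set"
    and us :: "('k::field) mpoly list"
    and u :: "'k mpoly"
  assumes "n \<ge> 1" and "d \<ge> 1"
    and "\<forall>j\<in>{1..d - 1}. t j \<ge> 1"
    and "\<forall>j\<in>{1..d}. V j \<noteq> {} \<and> V j \<subseteq> {1..n}"
    and "\<forall>i\<in>{1..d}. \<forall>j\<in>{1..d}. i \<noteq> j \<longrightarrow> V i \<inter> V j = {}"
    and "\<forall>i\<in>{1..d}. \<forall>j\<in>{1..d}. i < j \<longrightarrow> (\<forall>p\<in>V i. \<forall>q\<in>V j. p < q)"
    and "no_isolated_vertices (complete_spread_hypergraph d t V)"
    and "minimal_monomial_generators n (edge_ideal n (complete_spread_hypergraph d t V)) (set us)"
    and "sorted_wrt lex_greater us"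
    and "m < length us" and "us ! m = u"
    and "u = (\<Prod>j\<in>{1..d}. var (k j))"
    and "\<forall>j\<in>{1..d}. k j \<in> V j"
  shows "set_of_generator n us m =
           {Min (V 1)..k 1 - 1} \<inter> V 1 \<union>
           (\<Union>j\<in>{2..d}. {k (j - 1) + t (j - 1)..k j - 1} \<inter> V j)"
proof -
  note V = assms(4) and disjoint = assms(5) and k = assms(13)
  define A where "A = indicator_exponent ` {e. spread_edge d t V e}"
  let ?e = "k ` {1..d}"
  have edge_ideal: "edge_ideal n (complete_spread_hypergraph d t V) =
      (Idl\<^bsub>polynomial_ring n\<^esub> (monomial ` A) :: 'k mpoly set)"
    unfolding edge_ideal_def complete_spread_hypergraph_def A_def
    by (rule arg_cong[where f = "genideal _"]) (auto simp: prod_var_eq_monomial)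
  have A: "Poly_Mapping.keys a \<subseteq> {1..n}" if a: "a \<in> A" for a
  proof -
    obtain e where e: "spread_edge d t V e" "a = indicator_exponent e"
      using a by (auto simp: A_def)
    then have "Poly_Mapping.keys a = e"
      by (simp add: keys_indicator_exponent finite_spread_edge)
    moreover obtain k' where "e = k' ` {1..d}" "\<forall>j\<in>{1..d}. k' j \<in> V j"
      using e unfolding spread_edge_def by blast
    then have "e \<subseteq> {1..n}"
      using V by blast
    ultimately show ?thesis
      by simp
  qed
  have antichain: "a = b" if ab: "a \<in> A" "b \<in> A" "exp_dvd a b" for a b
  proof -
    obtain e f where "a = indicator_exponent e" "b = indicator_exponent f"
      and edges: "spread_edge d t V e" "spread_edge d t V f"
      using ab by (auto simp: A_def)
    moreover have "e = f"
      using calculation ab card_spread_edge[OF disjoint]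
      by (metis card_subset_eq exp_dvd_indicator_exponent finite_spread_edge)
    ultimately show ?thesis
      by simp
  qed
  have us: "set us = monomial ` A"
    using minimal_monomial_generators_antichain[OF A antichain] assms(8)
    unfolding edge_ideal by blast
  have "inj_on k {1..d}"
    using k transversal_index_eq[OF disjoint] by (metis inj_onI)
  then have u: "us ! m = monomial (indicator_exponent ?e)"
    unfolding assms(11,12)
    by (simp add: prod.reindex flip: prod_var_eq_monomial)
  \<comment> \<open>The theorem takes \<open>k j\<close> from \<open>V j\<close> only; the gaps come from \<open>u\<close> being a generator.\<close>
  have edge: "spread_edge d t V ?e"
  proof -
    have "indicator_exponent ?e \<in> A"
      using us u assms(10) by (metis imageE monomial_eq_iff nth_mem)
    then obtain e where "spread_edge d t V e" "indicator_exponent ?e = indicator_exponent e"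
      by (auto simp: A_def)
    then show ?thesis
      by (metis finite_atLeastAtMost finite_imageI finite_spread_edge keys_indicator_exponent)
  qed
  have "i \<in> set_of_generator n us m \<longleftrightarrow>
      (\<exists>j\<in>{1..d}. i \<in> V j \<and> i < k j \<and> (2 \<le> j \<longrightarrow> k (j - 1) + t (j - 1) \<le> i))" for i
  proof -
    have "i \<in> set_of_generator n us m \<longleftrightarrow>
        i \<in> {1..n} \<and> (\<exists>a\<in>A. indicator_exponent ?e < a \<and>
          exp_dvd a (Poly_Mapping.single i 1 + indicator_exponent ?e))"
      using us A assms(9,10) u by (rule in_set_of_generator_iff)
    also have "\<dots> \<longleftrightarrow> i \<in> {1..n} \<and> (\<exists>f. spread_edge d t V f \<and> f \<subseteq> insert i ?e \<and>
        indicator_exponent ?e < indicator_exponent f)"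
      using exp_dvd_var_times_indicator_exponent[OF finite_spread_edge[OF edge] finite_spread_edge]
      unfolding A_def by blast
    finally show ?thesis
      unfolding exchange_iff[OF disjoint k edge] using V by blast
  qed
  moreover have "{Min (V 1)..k 1 - 1} \<inter> V 1 = {i \<in> V 1. i < k 1}"
  proof -
    have "V 1 \<subseteq> {1..n}" "k 1 \<in> V 1"
      using V k assms(2) by simp_all
    then have "finite (V 1)" "k 1 \<ge> 1"
      using finite_subset by auto
    then show ?thesis
      by auto
  qed
  moreover have "{k (j - 1) + t (j - 1)..k j - 1} \<inter> V j =
      {i \<in> V j. i < k j \<and> k (j - 1) + t (j - 1) \<le> i}" if j: "j \<in> {2..d}" for j
  proof -
    have "j \<in> {1..d}"
      using j by simp
    then have "k j \<in> {1..n}"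
      using V k by blast
    then show ?thesis
      by auto
  qed
  moreover have "{1..d} = insert 1 {2..d}"
    using assms(2) by auto
  ultimately show ?thesis
    by auto
qed

end
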